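(* Let $DEFG$ be a unit square inscribed in a triangle $\Delta ABC$ with the side $DE$ of the square lying on the side $AB$ of the triangle, and let $h$ be the height of $\Delta ABC$ from $C$ (the distance from $C$ to the line $AB$). Then $h = 2$ if and only if the area $(ABC)$ is the minimum possible area among all triangles in which the unit square is inscribed in this way; and this minimum area is $2$.
   Context: A unit square $DEFG$ (vertices labeled in cyclic order, all sides of length $1$) is inscribed in the triangle $\Delta ABC$ if all vertices of the square lie on the sides of the triangle; here $D,E$ lie on the side $AB$, $F$ lies on the side $BC$ and $G$ lies on the side $CA$. There are no obtuse angles at $A$ or $B$. $(ABC)$ denotes the area of $\Delta ABC$. *)

theory Defs
  imports "HOL-Analysis.Analysis"
begin

definition angle_at :: "real^2 \<Rightarrow> real^2 \<Rightarrow> real^2 \<Rightarrow> real" where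
  "angle_at P Q R = arccos (((P - Q) \<bullet> (R - Q)) / (norm (P - Q) * norm (R - Q)))"

definition is_triangle :: "real^2 \<Rightarrow> real^2 \<Rightarrow> real^2 \<Rightarrow> bool" where
  "is_triangle A B C \<longleftrightarrow> \<not> collinear {A, B, C}"

definition triangle_area :: "real^2 \<Rightarrow> real^2 \<Rightarrow> real^2 \<Rightarrow> real" where
  "triangle_area A B C = measure lebesgue (convex hull {A, B, C})"

definition height_from :: "real^2 \<Rightarrow> real^2 \<Rightarrow> real^2 \<Rightarrow> real" where
  "height_from C A B = infdist C (affine hull {A, B})"

(* Requiring right angles at all four vertices excludes the degenerate closed
   path with F = D, which has four unit sides and right angles at D and F only. *)
definition unit_square :: "real^2 \<Rightarrow> real^2 \<Rightarrow> real^2 \<Rightarrow> real^2 \<Rightarrow> bool" where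
  "unit_square D E F G \<longleftrightarrow>
     dist D E = 1 \<and> dist E F = 1 \<and> dist F G = 1 \<and> dist G D = 1 \<and>
     orthogonal (G - D) (E - D) \<and> orthogonal (D - E) (F - E) \<and>
     orthogonal (E - F) (G - F) \<and> orthogonal (F - G) (D - G)"

definition inscribed_unit_square ::
  "real^2 \<Rightarrow> real^2 \<Rightarrow> real^2 \<Rightarrow> real^2 \<Rightarrow> real^2 \<Rightarrow> real^2 \<Rightarrow> real^2 \<Rightarrow> bool" where
  "inscribed_unit_square A B C D E F G \<longleftrightarrow>
     is_triangle A B C \<and>
     angle_at C A B \<le> pi / 2 \<and> angle_at A B C \<le> pi / 2 \<and>
     unit_square D E F G \<and>
     D \<in> closed_segment A B \<and> E \<in> closed_segment A B \<and>
     F \<in> closed_segment B C \<and> G \<in> closed_segment C A"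

(* The position of the square in the plane is not fixed: all unit squares are
   congruent, so this is the same set of areas as for any one particular square. *)
definition admissible_areas :: "real set" where
  "admissible_areas =
     {triangle_area A B C | A B C. \<exists>D E F G. inscribed_unit_square A B C D E F G}"

definition is_minimum :: "real \<Rightarrow> real set \<Rightarrow> bool" where
  "is_minimum m S \<longleftrightarrow> m \<in> S \<and> (\<forall>x\<in>S. m \<le> x)"

end

theory Submission
  imports Defs
begin

text \<open>
  Let \<open>c\<close> be the length of \<open>AB\<close> and \<open>h\<close> the height from \<open>C\<close>. The side \<open>FG\<close> of the square is
  parallel to \<open>AB\<close>, so it cuts off at \<open>C\<close> a triangle similar to \<open>ABC\<close>, with base \<open>1\<close> and
  height \<open>h - 1\<close>. Hence \<open>c (h - 1) = h\<close> (lemma \<open>inscribed_base_height\<close>). Since the area is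
  \<open>c h / 2\<close>, it depends on \<open>h\<close> alone:
  \<open>h\<^sup>2 / (2 (h - 1)) = 2 + (h - 2)\<^sup>2 / (2 (h - 1))\<close> (lemma \<open>inscribed_area_excess\<close>).
  As \<open>h > 1\<close>, the excess over \<open>2\<close> is nonnegative and vanishes exactly for \<open>h = 2\<close>. One explicit
  triangle of height \<open>2\<close> shows that the bound \<open>2\<close> is attained.

  Similarity is expressed through the planar cross product \<open>cross2\<close>, a signed area: the factor
  \<open>B - A\<close> turns it into a multiple of the signed distance from the line \<open>AB\<close>. Area, height,
  collinearity and parallelism all become statements about this one bilinear form.
\<close>

definition cross2 :: "real^2 \<Rightarrow> real^2 \<Rightarrow> real" where
  "cross2 u v = u$1 * v$2 - u$2 * v$1"

lemma cross2_simps: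
  "cross2 u (v + w) = cross2 u v + cross2 u w"
  "cross2 u (v - w) = cross2 u v - cross2 u w"
  "cross2 u (r *\<^sub>R v) = r * cross2 u v"
  "cross2 (r *\<^sub>R u) v = r * cross2 u v"
  "cross2 u u = 0"
  by (simp_all add: cross2_def algebra_simps)

text \<open>Lagrange's identity in the plane (\<open>sin\<^sup>2 + cos\<^sup>2 = 1\<close>). It links the cross product to
  lengths and yields both the bound below and its equality case for orthogonal vectors.\<close>

lemma cross2_square: "(cross2 u v)\<^sup>2 + (u \<bullet> v)\<^sup>2 = (norm u)\<^sup>2 * (norm v)\<^sup>2"
  unfolding power2_norm_eq_inner
  by (simp add: cross2_def inner_vec_def sum_2 power2_eq_square algebra_simps)

lemma abs_cross2_le: "\<bar>cross2 u v\<bar> \<le> norm u * norm v"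
proof -
  have "(cross2 u v)\<^sup>2 \<le> (norm u * norm v)\<^sup>2"
    using cross2_square[of u v] zero_le_power2[of "u \<bullet> v"]
    unfolding power_mult_distrib by linarith
  then show ?thesis
    by (simp flip: abs_le_square_iff add: abs_mult)
qed

lemma abs_cross2_orthogonal:
  assumes "u \<bullet> v = 0"
  shows "\<bar>cross2 u v\<bar> = norm u * norm v"
proof -
  have "(cross2 u v)\<^sup>2 = (norm u * norm v)\<^sup>2"
    using cross2_square[of u v] assms by (simp add: power_mult_distrib)
  then show ?thesis
    by (auto simp: power2_eq_iff)
qed

text \<open>In dimension two the vectors orthogonal to a nonzero \<open>n\<close> form a line, so any two of them
  are parallel.\<close>

lemma cross2_eq_0_if_common_normal:
  assumes "n \<noteq> 0" "u \<bullet> n = 0" "v \<bullet> n = 0"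
  shows "cross2 u v = 0"
proof -
  have "cross2 u v * n$1 = 0" "cross2 u v * n$2 = 0"
    using assms(2,3) unfolding cross2_def inner_vec_def sum_2 by simp_all algebra+
  moreover have "n$1 \<noteq> 0 \<or> n$2 \<noteq> 0"
    using assms(1) by (auto simp: vec_eq_iff forall_2)
  ultimately show ?thesis by auto
qed

lemma triangle_area_eq_cross2: "triangle_area A B C = \<bar>cross2 (B - A) (C - A)\<bar> / 2"
proof -
  have "compact (convex hull {A, B, C})"
    by (intro compact_convex_hull finite_imp_compact) simp
  then have "triangle_area A B C = measure lborel (convex hull {A, B, C})"
    unfolding triangle_area_def
    by (intro measure_completion) (simp add: borel_closed compact_imp_closed)
  then show ?thesis
    by (simp add: content_triangle cross2_def abs_minus_commute mult.commute)
qed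

text \<open>Collinearity is the equality case of the Cauchy--Schwarz inequality, and by
  \<open>cross2_square\<close> the defect in that inequality is the square of the cross product.\<close>

lemma is_triangle_iff_cross2: "is_triangle A B C \<longleftrightarrow> cross2 (B - A) (C - A) \<noteq> 0"
proof -
  let ?u = "B - A" and ?v = "C - A"
  have "collinear {A, B, C} \<longleftrightarrow> collinear {0, B - A, C - A}"
    using collinear_3[of B A C] by (simp add: insert_commute)
  also have "\<dots> \<longleftrightarrow> \<bar>(B - A) \<bullet> (C - A)\<bar> = norm (B - A) * norm (C - A)"
    by (simp add: norm_cauchy_schwarz_equal)
  also have "\<dots> \<longleftrightarrow> ((B - A) \<bullet> (C - A))\<^sup>2 = (norm (B - A))\<^sup>2 * (norm (C - A))\<^sup>2"
    using power2_eq_iff_nonneg[of "\<bar>?u \<bullet> ?v\<bar>" "norm ?u * norm ?v"]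
    by (simp add: power_mult_distrib)
  also have "\<dots> \<longleftrightarrow> cross2 (B - A) (C - A) = 0"
    using cross2_square[of "B - A" "C - A"] by auto
  finally show ?thesis by (simp add: is_triangle_def)
qed

text \<open>The cross product with \<open>B - A\<close> takes the same value on \<open>C - x\<close> for every \<open>x\<close> on the line
  \<open>AB\<close>. That value bounds all distances from \<open>C\<close> to the line from below, and the foot of the
  perpendicular attains the bound.\<close>

lemma base_times_height_from:
  assumes "A \<noteq> B"
  shows "norm (B - A) * height_from C A B = \<bar>cross2 (B - A) (C - A)\<bar>"
proof -
  let ?u = "B - A"
  define k where "k = ((C - A) \<bullet> ?u) / (?u \<bullet> ?u)"
  define P where "P = A + k *\<^sub>R ?u"
  have hull: "affine hull {A, B} = range (\<lambda>r. A + r *\<^sub>R ?u)"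
    using affine_hull_2_alt[of A B] by auto
  have cross: "cross2 ?u (C - (A + r *\<^sub>R ?u)) = cross2 ?u (C - A)" for r
    by (simp add: cross2_def algebra_simps)
  have uu: "?u \<bullet> ?u \<noteq> 0" using assms by simp
  have "?u \<bullet> (C - P) = 0"
    using uu by (simp add: P_def k_def inner_diff_right inner_add_right inner_commute)
  then have foot: "norm ?u * dist C P = \<bar>cross2 ?u (C - A)\<bar>"
    using abs_cross2_orthogonal cross[of k] by (metis P_def dist_norm)
  have "dist C P \<le> dist C x" if "x \<in> affine hull {A, B}" for x
  proof -
    have "\<bar>cross2 ?u (C - A)\<bar> \<le> norm ?u * dist C x"
      using that abs_cross2_le[of ?u "C - x"] cross by (auto simp: hull dist_norm)
    then have "norm ?u * dist C P \<le> norm ?u * dist C x" using foot by simp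
    then show ?thesis using assms by simp
  qed
  moreover have "P \<in> affine hull {A, B}" by (auto simp: hull P_def)
  ultimately have "infdist C (affine hull {A, B}) = dist C P"
    by (intro antisym infdist_le) (auto simp: infdist_def intro!: cINF_greatest)
  then show ?thesis using foot by (simp add: height_from_def)
qed

lemma triangle_area_base_height:
  assumes "A \<noteq> B"
  shows "triangle_area A B C = norm (B - A) * height_from C A B / 2"
  using base_times_height_from[OF assms] by (simp add: triangle_area_eq_cross2)

text \<open>The similar triangles. Write \<open>F\<close> as the point at ratio \<open>t\<close> on the way from \<open>B\<close> to \<open>C\<close>. As \<open>FG\<close>
  is parallel to \<open>AB\<close>, the point \<open>G\<close> is at the same ratio on the way from \<open>A\<close> to \<open>C\<close>, so
  \<open>FG\<close> has length \<open>(1 - t) c = 1\<close>; and \<open>F\<close> lies at distance \<open>t h = 1\<close> from \<open>AB\<close>. Eliminating \<open>t\<close>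
  gives the relation. The argument is the same whichever of \<open>D\<close>, \<open>E\<close> is closer to \<open>A\<close>.\<close>

lemma inscribed_base_height:
  assumes "inscribed_unit_square A B C D E F G"
  shows "norm (B - A) * (height_from C A B - 1) = height_from C A B"
    and "height_from C A B > 1" and "A \<noteq> B"
proof -
  let ?u = "B - A" and ?v = "C - A" and ?c = "norm (B - A)" and ?h = "height_from C A B"
  have tri: "cross2 ?u ?v \<noteq> 0" and sq: "unit_square D E F G"
    and seg: "D \<in> closed_segment A B" "E \<in> closed_segment A B"
      "F \<in> closed_segment B C" "G \<in> closed_segment A C"
    using assms
    by (auto simp: inscribed_unit_square_def is_triangle_iff_cross2 closed_segment_commute)
  show AB: "A \<noteq> B" using tri by (auto simp: cross2_def)
  then have c: "?c > 0" by simp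
  have area: "?c * ?h = \<bar>cross2 ?u ?v\<bar>" by (rule base_times_height_from[OF AB])
  then have h: "?h > 0" using tri c by (metis zero_less_abs_iff zero_less_mult_pos)
  obtain d where "D = (1 - d) *\<^sub>R A + d *\<^sub>R B" using seg(1) by (auto simp: in_segment)
  then have D: "D - A = d *\<^sub>R ?u" by (simp add: algebra_simps)
  obtain e where "E = (1 - e) *\<^sub>R A + e *\<^sub>R B" using seg(2) by (auto simp: in_segment)
  then have E: "E - A = e *\<^sub>R ?u" by (simp add: algebra_simps)
  obtain t where t: "0 \<le> t" "t \<le> 1" and "F = (1 - t) *\<^sub>R B + t *\<^sub>R C"
    using seg(3) by (auto simp: in_segment)
  then have F: "F - A = (1 - t) *\<^sub>R ?u + t *\<^sub>R ?v" by (simp add: algebra_simps)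
  obtain s where "G = (1 - s) *\<^sub>R A + s *\<^sub>R C" using seg(4) by (auto simp: in_segment)
  then have G: "G - A = s *\<^sub>R ?v" by (simp add: algebra_simps)
  have "E - D = (E - A) - (D - A)" by simp
  then have ED: "E - D = (e - d) *\<^sub>R ?u" unfolding D E by (simp add: scaleR_left_diff_distrib)
  have "dist D E = 1" "dist E F = 1" "dist F G = 1"
    and orth: "(E - D) \<bullet> (F - E) = 0" "(F - G) \<bullet> (F - E) = 0"
    using sq by (auto simp: unit_square_def orthogonal_def inner_diff_left inner_diff_right inner_commute)
  then have norms: "norm (E - D) = 1" "norm (F - E) = 1" "norm (F - G) = 1"
    by (simp_all add: dist_norm norm_minus_commute)
  have "e \<noteq> d" using norms(1) ED by auto
  then have uF: "?u \<bullet> (F - E) = 0" using orth(1) ED by simp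
  \<comment> \<open>Both \<open>FG\<close> and \<open>AB\<close> are orthogonal to \<open>EF\<close>, so the component of \<open>F - G\<close> along \<open>AC\<close> vanishes.\<close>
  have "F - G = (F - A) - (G - A)" by simp
  then have FG: "F - G = (1 - t) *\<^sub>R ?u + (t - s) *\<^sub>R ?v"
    unfolding F G by (simp add: algebra_simps)
  have "cross2 ?u (F - G) = 0"
    using cross2_eq_0_if_common_normal uF orth(2) norms(2) by (metis norm_zero zero_neq_one)
  then have "t - s = 0" using tri unfolding FG cross2_simps by simp
  then have "F - G = (1 - t) *\<^sub>R ?u" using FG by simp
  then have side: "(1 - t) * ?c = 1" using norms(3) t by simp
  \<comment> \<open>\<open>EF\<close> is perpendicular to \<open>AB\<close>, so its length \<open>1\<close> is the distance from \<open>F\<close> to \<open>AB\<close>, which is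
    \<open>t\<close> times that of \<open>C\<close>.\<close>
  have "F - E = (F - A) - (E - A)" by simp
  then have "F - E = (1 - t - e) *\<^sub>R ?u + t *\<^sub>R ?v"
    unfolding E F by (simp add: algebra_simps)
  then have "cross2 ?u (F - E) = t * cross2 ?u ?v" by (simp add: cross2_simps)
  then have "?c = t * (?c * ?h)"
    using abs_cross2_orthogonal[OF uF] norms(2) t area by (simp add: abs_mult)
  then have th: "t * ?h = 1" using c by (simp add: field_simps)
  show eq: "?c * (?h - 1) = ?h"
    using side th by algebra
  then show "?h > 1" using c h by (smt (verit) zero_less_mult_pos)
qed

text \<open>Completing the square in \<open>h\<^sup>2 / (2 (h - 1))\<close> displays the minimum and the place where it is
  attained at once.\<close>

lemma inscribed_area_excess:
  assumes "inscribed_unit_square A B C D E F G"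
  shows "triangle_area A B C
           = 2 + (height_from C A B - 2)\<^sup>2 / (2 * (height_from C A B - 1))"
proof -
  note bh = inscribed_base_height[OF assms]
  have "norm (B - A) = height_from C A B / (height_from C A B - 1)"
    using bh(1,2) by (simp add: field_simps)
  then show ?thesis
    using bh(2) unfolding triangle_area_base_height[OF bh(3)]
    by (simp add: field_simps power2_eq_square)
qed

lemma angle_at_le_right_angle:
  assumes "0 \<le> (P - Q) \<bullet> (R - Q)"
  shows "angle_at P Q R \<le> pi / 2"
  unfolding angle_at_def
  using assms norm_cauchy_schwarz[of "P - Q" "R - Q"]
  by (intro arccos_le_pi2) (auto simp: divide_le_eq_1 zero_le_mult_iff less_le)

text \<open>Area \<open>2\<close> is attained by the right-angled isosceles triangle with legs of length \<open>2\<close>;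
  the angle bound at \<open>A\<close> holds there with equality.\<close>

lemma right_angled_witness:
  "inscribed_unit_square 0 (vector [2, 0]) (vector [0, 2])
     0 (vector [1, 0]) (vector [1, 1]) (vector [0, 1])"
  unfolding inscribed_unit_square_def is_triangle_iff_cross2
proof (intro conjI)
  let ?B = "vector [2, 0] :: real^2" and ?C = "vector [0, 2] :: real^2"
  show "cross2 (?B - 0) (?C - 0) \<noteq> 0" by (simp add: cross2_def)
  show "angle_at ?C 0 ?B \<le> pi / 2"
    by (rule angle_at_le_right_angle) (simp add: inner_vec_def sum_2)
  show "angle_at 0 ?B ?C \<le> pi / 2"
    by (rule angle_at_le_right_angle) (simp add: inner_vec_def sum_2)
  show "unit_square 0 (vector [1, 0]) (vector [1, 1]) (vector [0, 1])"
    by (simp add: unit_square_def orthogonal_def dist_norm norm_eq_sqrt_inner inner_vec_def sum_2)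
  show "0 \<in> closed_segment 0 ?B" by simp
  show "vector [1, 0] \<in> closed_segment 0 ?B"
    unfolding in_segment by (rule exI[of _ "1/2"]) (simp add: vec_eq_iff forall_2)
  show "vector [1, 1] \<in> closed_segment ?B ?C"
    unfolding in_segment by (rule exI[of _ "1/2"]) (simp add: vec_eq_iff forall_2)
  show "vector [0, 1] \<in> closed_segment ?C 0"
    unfolding in_segment by (rule exI[of _ "1/2"]) (simp add: vec_eq_iff forall_2)
qed

lemma minimum_admissible_area: "is_minimum 2 admissible_areas"
  unfolding is_minimum_def
proof
  have "triangle_area 0 (vector [2, 0]) (vector [0, 2]) = 2"
    by (simp add: triangle_area_eq_cross2 cross2_def)
  then show "2 \<in> admissible_areas"
    using right_angled_witness unfolding admissible_areas_def mem_Collect_eq by metis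
  show "\<forall>x\<in>admissible_areas. 2 \<le> x"
  proof
    fix x assume "x \<in> admissible_areas"
    then obtain A B C D E F G
      where "x = triangle_area A B C" and ins: "inscribed_unit_square A B C D E F G"
      unfolding admissible_areas_def by auto
    then show "2 \<le> x"
      using inscribed_area_excess[OF ins] inscribed_base_height(2)[OF ins] by simp
  qed
qed

theorem theorem1:
  "(\<forall>A B C D E F G :: real^2. inscribed_unit_square A B C D E F G \<longrightarrow>
      (height_from C A B = 2 \<longleftrightarrow> is_minimum (triangle_area A B C) admissible_areas))
   \<and> is_minimum 2 admissible_areas"
proof (intro conjI allI impI)
  fix A B C D E F G :: "real^2"
  assume ins: "inscribed_unit_square A B C D E F G"
  have "is_minimum (triangle_area A B C) admissible_areas \<longleftrightarrow> triangle_area A B C = 2"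
    using minimum_admissible_area unfolding is_minimum_def by (metis order_antisym)
  also have "\<dots> \<longleftrightarrow> height_from C A B = 2"
    using inscribed_area_excess[OF ins] inscribed_base_height(2)[OF ins] by simp
  finally show "height_from C A B = 2 \<longleftrightarrow> is_minimum (triangle_area A B C) admissible_areas"
    by simp
qed (rule minimum_admissible_area)

end
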